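(* Let $q$ be a prime power and let $n,k,d$ be integers with $1\le k\le n$ and $d\ge 1$. If $$\sum_{i=1}^{d-1}\binom{n}{i}(q^2-1)^i<\frac{q^{2n}-1}{q^k-1},$$ then there exists a symplectic self-orthogonal $\mathbb{F}_q$-linear code $C\subseteq\mathbb{F}_q^{2n}$ of dimension $k$ whose symplectic minimum distance satisfies $d_S(C)\ge d$.
   Context: Let $\mathbb{F}_q$ be the finite field with $q$ elements. Vectors of $\mathbb{F}_q^{2n}$ are written $(\mathbf{a}|\mathbf{b})$ with $\mathbf{a},\mathbf{b}\in\mathbb{F}_q^n$. The symplectic inner product is $\langle(\mathbf{a}|\mathbf{b}),(\mathbf{a}'|\mathbf{b}')\rangle_S=\langle\mathbf{a},\mathbf{b}'\rangle_E-\langle\mathbf{b},\mathbf{a}'\rangle_E$, where $\langle\cdot,\cdot\rangle_E$ is the ordinary dot product on $\mathbb{F}_q^n$. For an $\mathbb{F}_q$-linear code (subspace) $C\subseteq\mathbb{F}_q^{2n}$, the symplectic dual is $C^{\perp_S}=\{(\mathbf{x}|\mathbf{y})\in\mathbb{F}_q^{2n}: \langle(\mathbf{x}|\mathbf{y}),(\mathbf{a}|\mathbf{b})\rangle_S=0 \text{ for all } (\mathbf{a}|\mathbf{b})\in C\}$, and $C$ is symplectic self-orthogonal if $C\subseteq C^{\perp_S}$. The symplectic weight of $(\mathbf{a}|\mathbf{b})=(a_1,\dots,a_n|b_1,\dots,b_n)$ is $\mathrm{wt}_S(\mathbf{a}|\mathbf{b})=|\{i\in\{1,\dots,n\}:(a_i,b_i)\ne(0,0)\}|$,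 and the symplectic minimum distance of a nonzero linear code $C$ is $d_S(C)=\min\{\mathrm{wt}_S(\mathbf{a}|\mathbf{b}):(\mathbf{a}|\mathbf{b})\in C\setminus\{(\mathbf{0}|\mathbf{0})\}\}$. *)

theory Defs
  imports "HOL-Analysis.Cartesian_Space"
begin

text \<open>
  The space of dimension \<open>2n\<close> over a finite field \<open>'a\<close> is \<open>'a ^ ('n + 'n)\<close> with
  \<open>n = CARD('n)\<close>. The vector \<open>(a|b)\<close> has its \<open>a\<close>-coordinates at the indices
  \<open>Inl i\<close> and its \<open>b\<close>-coordinates at the indices \<open>Inr i\<close>. Linear codes and their
  dimension are the library's \<open>vec.subspace\<close> and \<open>vec.dim\<close>.
\<close>

definition lhalf :: "'a ^ ('n::finite + 'n) \<Rightarrow> 'a ^ 'n" where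
  "lhalf v = (\<chi> i. v $ Inl i)"

definition rhalf :: "'a ^ ('n::finite + 'n) \<Rightarrow> 'a ^ 'n" where
  "rhalf v = (\<chi> i. v $ Inr i)"

definition dot_prod :: "'a::field ^ 'n::finite \<Rightarrow> 'a ^ 'n \<Rightarrow> 'a" where
  "dot_prod x y = (\<Sum>i\<in>UNIV. x $ i * y $ i)"

definition symp_prod :: "'a::field ^ ('n::finite + 'n) \<Rightarrow> 'a ^ ('n + 'n) \<Rightarrow> 'a" where
  "symp_prod u v = dot_prod (lhalf u) (rhalf v) - dot_prod (rhalf u) (lhalf v)"

definition symp_dual :: "('a::field ^ ('n::finite + 'n)) set \<Rightarrow> ('a ^ ('n + 'n)) set" where
  "symp_dual C = {u. \<forall>v\<in>C. symp_prod u v = 0}"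

definition symp_self_orthogonal :: "('a::field ^ ('n::finite + 'n)) set \<Rightarrow> bool" where
  "symp_self_orthogonal C \<longleftrightarrow> C \<subseteq> symp_dual C"

definition symp_weight :: "'a::field ^ ('n::finite + 'n) \<Rightarrow> nat" where
  "symp_weight v = card {i. (lhalf v $ i, rhalf v $ i) \<noteq> (0, 0)}"

text \<open>Meaningful only for codes \<open>C\<close> with a nonzero element; \<open>Min {}\<close> is unspecified.\<close>

definition symp_min_dist :: "('a::{field,finite} ^ ('n::finite + 'n)) set \<Rightarrow> nat" where
  "symp_min_dist C = Min (symp_weight ` (C - {0}))"

end

theory Submission
  imports Defs
begin

text \<open>
  Symplectic transvections act transitively on the nonzero vectors, so every nonzero vector lies
  in the same number \<open>M\<close> of self-orthogonal codes of dimension \<open>k\<close>. If \<open>N\<close> is the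
  number of all such codes, counting incident pairs gives \<open>N (q^k - 1) = M (q^(2n) - 1)\<close>. If
  each of the \<open>N > 0\<close> codes contained one of the \<open>B\<close> nonzero vectors of weight below
  \<open>d\<close>, then \<open>N \<le> B M\<close>, which contradicts the bound
  \<open>B < (q^(2n) - 1) / (q^k - 1)\<close>.
\<close>

section \<open>Cardinality of subspaces over a finite field\<close>

lemma card_span_independent:
  fixes S :: "('a::{field,finite} ^ 'm::finite) set"
  assumes "vec.independent S"
  shows "card (vec.span S) = CARD('a) ^ card S"
proof -
  have "finite S" by simp
  then show ?thesis using assms
  proof (induction S)
    case empty
    then show ?case by simp
  next
    case (insert b S)
    have b: "b \<notin> vec.span S" and ind: "vec.independent S"
      using insert.prems insert.hyps by (auto simp: vec.independent_insert)
    \<comment> \<open>Each vector of the larger span is \<open>c *s b + x\<close> for exactly one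
      scalar \<open>c\<close> and one \<open>x\<close> in the old span, so adjoining
      \<open>b\<close> multiplies the cardinality by \<open>CARD('a)\<close>.\<close>
    let ?f = "\<lambda>(c, x). c *s b + x"
    have inj: "inj_on ?f (UNIV \<times> vec.span S)"
    proof (rule inj_onI; clarsimp)
      fix c x c' x'
      assume x: "x \<in> vec.span S" "x' \<in> vec.span S" and eq: "c *s b + x = c' *s b + x'"
      have *: "(c - c') *s b = x' - x"
        using eq by (simp add: vec.scale_left_diff_distrib algebra_simps)
      have "c = c'"
      proof (rule ccontr)
        assume "c \<noteq> c'"
        \<comment> \<open>Two different coefficients would allow solving for \<open>b\<close> inside
          the span of \<open>S\<close>.\<close>
        then have "b = inverse (c - c') *s (x' - x)"
          unfolding *[symmetric] by (simp only: vec.scale_scale) simp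
        also have "\<dots> \<in> vec.span S"
          using x by (intro vec.span_scale vec.span_diff)
        finally show False
          using b by blast
      qed
      then show "c = c' \<and> x = x'" using eq by simp
    qed
    have "vec.span (insert b S) = ?f ` (UNIV \<times> vec.span S)"
    proof (intro set_eqI iffI)
      fix y assume "y \<in> vec.span (insert b S)"
      then obtain c where "y - c *s b \<in> vec.span S"
        by (auto simp: vec.span_breakdown_eq)
      then show "y \<in> ?f ` (UNIV \<times> vec.span S)"
        by (intro image_eqI[of _ _ "(c, y - c *s b)"]) auto
    next
      fix y assume "y \<in> ?f ` (UNIV \<times> vec.span S)"
      then obtain c x where "x \<in> vec.span S" "y = c *s b + x" by auto
      then show "y \<in> vec.span (insert b S)"
        unfolding vec.span_breakdown_eq by (intro exI[of _ c]) simp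
    qed
    then show ?case
      using insert ind by (simp add: card_image[OF inj] card_cartesian_product)
  qed
qed

lemma card_subspace:
  fixes C :: "('a::{field,finite} ^ 'm::finite) set"
  assumes "vec.subspace C"
  shows "card C = CARD('a) ^ vec.dim C"
proof -
  obtain B where "B \<subseteq> C" "vec.independent B" "C \<subseteq> vec.span B" "card B = vec.dim C"
    using vec.basis_exists by blast
  then show ?thesis
    using card_span_independent[of B] vec.span_subspace[of B C] assms by metis
qed

lemma two_le_card_field: "2 \<le> CARD('a::{field,finite})"
proof -
  have "card {0, 1::'a} \<le> CARD('a)" by (rule card_mono) auto
  then show ?thesis by simp
qed

section \<open>The symplectic form\<close>

lemma symp_prod_eq:
  "symp_prod u v = (\<Sum>i\<in>UNIV. u $ Inl i * v $ Inr i - u $ Inr i * v $ Inl i)"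
  by (simp add: symp_prod_def dot_prod_def lhalf_def rhalf_def sum_subtractf)

lemma symp_prod_add_left: "symp_prod (u + u') v = symp_prod u v + symp_prod u' v"
  unfolding symp_prod_eq sum.distrib[symmetric] by (rule sum.cong) (auto simp: algebra_simps)

lemma symp_prod_scale_left: "symp_prod (c *s u) v = c * symp_prod u v"
  unfolding symp_prod_eq sum_distrib_left by (rule sum.cong) (auto simp: algebra_simps)

lemma symp_prod_skew: "symp_prod u v = - symp_prod v u"
  unfolding symp_prod_eq sum_negf[symmetric] by (rule sum.cong) (auto simp: algebra_simps)

text \<open>Every summand vanishes by commutativity. Skew symmetry alone would not give this in
  characteristic 2.\<close>

lemma symp_prod_self [simp]: "symp_prod u u = 0"
  unfolding symp_prod_eq by (rule sum.neutral) (auto simp: algebra_simps)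

lemma symp_prod_add_right: "symp_prod u (v + v') = symp_prod u v + symp_prod u v'"
  by (metis symp_prod_skew symp_prod_add_left minus_add_distrib)

lemma symp_prod_scale_right: "symp_prod u (c *s v) = c * symp_prod u v"
  by (metis symp_prod_skew symp_prod_scale_left mult_minus_right)

lemma symp_prod_diff_right: "symp_prod u (v - w) = symp_prod u v - symp_prod u w"
  using symp_prod_add_right[of u "v - w" w] by simp

lemmas symp_prod_bilinear =
  symp_prod_add_left symp_prod_scale_left symp_prod_add_right symp_prod_scale_right

lemma symp_prod_zero_left [simp]: "symp_prod 0 v = 0"
  by (simp add: symp_prod_eq)

lemma symp_prod_nondegenerate:
  fixes u :: "'a::field ^ ('n::finite + 'n)"
  assumes "u \<noteq> 0"
  obtains w where "symp_prod u w \<noteq> 0"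
proof -
  obtain j where j: "u $ j \<noteq> 0" using assms by (auto simp: vec_eq_iff)
  show ?thesis
  proof (cases j)
    case (Inl i)
    \<comment> \<open>The unit vector at the partner index isolates the nonzero coordinate; the
      other case differs only by a sign.\<close>
    have "symp_prod u (axis (Inr i) 1) = (\<Sum>l\<in>UNIV. if l = i then u $ Inl l else 0)"
      unfolding symp_prod_eq by (rule sum.cong) (auto simp: axis_def)
    also have "\<dots> = u $ Inl i" by simp
    finally have "symp_prod u (axis (Inr i) 1) = u $ Inl i" .
    then show ?thesis using that j Inl by metis
  next
    case (Inr i)
    have "symp_prod u (axis (Inl i) 1) = (\<Sum>l\<in>UNIV. if l = i then - (u $ Inr l) else 0)"
      unfolding symp_prod_eq by (rule sum.cong) (auto simp: axis_def)
    also have "\<dots> = - (u $ Inr i)" by simp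
    finally have "symp_prod u (axis (Inl i) 1) = - (u $ Inr i)" .
    then show ?thesis using that j Inr by (metis neg_equal_0_iff_equal)
  qed
qed

text \<open>The orthogonal complements of \<open>u\<close> and \<open>v\<close> are proper
  subspaces, and two proper subspaces never cover the space. If neither \<open>x\<close> nor
  \<open>y\<close> avoids both, then \<open>x + y\<close> does.\<close>

lemma symp_prod_common_nonorthogonal:
  fixes u v :: "'a::field ^ ('n::finite + 'n)"
  assumes "u \<noteq> 0" "v \<noteq> 0"
  obtains w where "symp_prod u w \<noteq> 0" "symp_prod v w \<noteq> 0"
proof -
  obtain x where x: "symp_prod u x \<noteq> 0" using symp_prod_nondegenerate[OF assms(1)] .
  obtain y where y: "symp_prod v y \<noteq> 0" using symp_prod_nondegenerate[OF assms(2)] .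
  consider "symp_prod v x \<noteq> 0" | "symp_prod u y \<noteq> 0"
    | "symp_prod v x = 0" "symp_prod u y = 0" by blast
  then show ?thesis
  proof cases
    case 3
    then show ?thesis using that[of "x + y"] x y by (simp add: symp_prod_add_right)
  qed (use that x y in auto)
qed

section \<open>Isometries and their transitivity on nonzero vectors\<close>

definition isometry :: "('a::field ^ ('n::finite + 'n) \<Rightarrow> 'a ^ ('n + 'n)) \<Rightarrow> bool" where
  "isometry T \<longleftrightarrow> Vector_Spaces.linear (*s) (*s) T \<and> (\<forall>x y. symp_prod (T x) (T y) = symp_prod x y)"

text \<open>A kernel vector is orthogonal to every vector, hence zero by nondegeneracy.\<close>

lemma isometry_inj:
  assumes "isometry T"
  shows "inj T"
proof -
  have lin: "Vector_Spaces.linear (*s) (*s) T" using assms by (simp add: isometry_def)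
  have "x = 0" if "T x = 0" for x
  proof (rule ccontr)
    assume "x \<noteq> 0"
    then obtain w where "symp_prod x w \<noteq> 0" using symp_prod_nondegenerate by blast
    moreover have "symp_prod x w = symp_prod (T x) (T w)" using assms by (simp add: isometry_def)
    ultimately show False using that by simp
  qed
  then show ?thesis using vec.linear_inj_iff_eq_0[OF lin] by blast
qed

lemma isometry_comp: "isometry S \<Longrightarrow> isometry T \<Longrightarrow> isometry (S \<circ> T)"
  by (auto simp: isometry_def intro: Vector_Spaces.linear_compose)

text \<open>The two cross terms in the product of the images cancel by skew symmetry, and the
  remaining term contains \<open>symp_prod a a = 0\<close>.\<close>

lemma isometry_transvection: "isometry (\<lambda>x. x + (c * symp_prod x a) *s a)"
  unfolding isometry_def
proof (intro conjI allI)
  show "Vector_Spaces.linear (*s) (*s) (\<lambda>x. x + (c * symp_prod x a) *s a)"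
    by unfold_locales (auto simp: vec_eq_iff symp_prod_bilinear algebra_simps)
  show "symp_prod (x + (c * symp_prod x a) *s a) (y + (c * symp_prod y a) *s a) = symp_prod x y"
    for x y
    by (simp add: symp_prod_bilinear symp_prod_skew[of a y])
qed

lemma isometry_step:
  assumes "symp_prod u v \<noteq> 0"
  obtains T where "isometry T" "T u = v"
proof
  \<comment> \<open>Since \<open>symp_prod u (v - u) = symp_prod u v\<close>, this scalar makes the
    transvection along \<open>v - u\<close> add exactly \<open>v - u\<close> to
    \<open>u\<close>.\<close>
  let ?c = "inverse (symp_prod u v)"
  let ?T = "\<lambda>x. x + (?c * symp_prod x (v - u)) *s (v - u)"
  show "isometry ?T" by (rule isometry_transvection)
  show "?T u = v" using assms by (simp add: symp_prod_diff_right)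
qed

lemma isometry_transitive:
  fixes u v :: "'a::field ^ ('n::finite + 'n)"
  assumes "u \<noteq> 0" "v \<noteq> 0"
  obtains T where "isometry T" "T u = v"
proof -
  \<comment> \<open>\<open>symp_prod u v\<close> may be zero, so one transvection need not suffice;
    the path goes through a \<open>w\<close> orthogonal to neither vector.\<close>
  obtain w where w: "symp_prod u w \<noteq> 0" "symp_prod v w \<noteq> 0"
    using symp_prod_common_nonorthogonal[OF assms] .
  then have "symp_prod w v \<noteq> 0" using symp_prod_skew[of w v] by simp
  then obtain S T where "isometry S" "S w = v" "isometry T" "T u = w"
    using w isometry_step by metis
  then show ?thesis using that[of "S \<circ> T"] isometry_comp by auto
qed

section \<open>Self-orthogonal codes and their incidence with vectors\<close>

definition isotropic_codes :: "nat \<Rightarrow> ('a::field ^ ('n::finite + 'n)) set set" where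
  "isotropic_codes k = {C. vec.subspace C \<and> vec.dim C = k \<and> symp_self_orthogonal C}"

lemma isotropic_codes_image:
  assumes "isometry T" "C \<in> isotropic_codes k"
  shows "T ` C \<in> isotropic_codes k"
proof -
  have lin: "Vector_Spaces.linear (*s) (*s) T" using assms by (simp add: isometry_def)
  have sub: "vec.subspace C" using assms by (simp add: isotropic_codes_def)
  have "vec.dim (T ` C) = vec.dim C"
    by (rule vec.dim_image_eq[OF lin]) (use isometry_inj[OF assms(1)] in \<open>auto intro: inj_on_subset\<close>)
  moreover have "vec.subspace (T ` C)"
    using vec.linear_subspace_image[OF lin sub] .
  ultimately show ?thesis using assms
    by (auto simp: isotropic_codes_def isometry_def symp_self_orthogonal_def symp_dual_def)
qed

lemma card_isotropic_codes_containing: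
  fixes u v :: "'a::{field,finite} ^ ('n::finite + 'n)"
  assumes "u \<noteq> 0" "v \<noteq> 0"
  shows "card {C \<in> isotropic_codes k. u \<in> C} = card {C \<in> isotropic_codes k. v \<in> C}"
proof -
  have "card {C \<in> isotropic_codes k. u \<in> C} \<le> card {C \<in> isotropic_codes k. v \<in> C}"
    if uv: "u \<noteq> 0" "v \<noteq> 0" for u v :: "'a ^ ('n + 'n)"
  proof -
    \<comment> \<open>Taking images under \<open>T\<close> embeds the codes through \<open>u\<close>
      into those through \<open>v\<close>; exchanging the two vectors gives equality.\<close>
    obtain T where T: "isometry T" "T u = v" using isometry_transitive[OF uv] .
    show ?thesis
    proof (rule card_inj_on_le[where f = "image T"])
      show "inj_on ((`) T) {C \<in> isotropic_codes k. u \<in> C}"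
        using isometry_inj[OF T(1)] by (auto simp: inj_on_def inj_image_eq_iff)
      show "(`) T ` {C \<in> isotropic_codes k. u \<in> C} \<subseteq> {C \<in> isotropic_codes k. v \<in> C}"
        using T isotropic_codes_image by blast
    qed simp
  qed
  then show ?thesis using assms by (intro order_antisym) blast+
qed

lemma isotropic_codes_nonempty:
  assumes "k \<le> CARD('n::finite)"
  shows "isotropic_codes k \<noteq> ({} :: ('a::{field,finite} ^ ('n + 'n)) set set)"
proof -
  obtain S :: "'n set" where S: "card S = k"
    using assms by (metis ex_card)
  \<comment> \<open>These unit vectors span a space whose second halves vanish, so all symplectic
    products on it are zero.\<close>
  let ?B = "(\<lambda>i. axis (Inl i) 1 :: 'a ^ ('n + 'n)) ` S"
  have "inj_on (\<lambda>i. axis (Inl i) 1 :: 'a ^ ('n + 'n)) S"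
    by (auto simp: inj_on_def axis_eq_axis)
  then have card: "card ?B = k" using S by (simp add: card_image)
  have ind: "vec.independent ?B"
    by (rule vec.independent_mono[OF independent_cart_basis]) (auto simp: cart_basis_def)
  have "vec.span ?B \<subseteq> {v. \<forall>i. v $ Inr i = 0}"
    by (rule vec.span_minimal) (auto simp: axis_def vec.subspace_def)
  then have "symp_self_orthogonal (vec.span ?B)"
    by (auto simp: symp_self_orthogonal_def symp_dual_def symp_prod_eq subset_iff)
  then have "vec.span ?B \<in> isotropic_codes k"
    using ind card by (simp add: isotropic_codes_def vec.dim_eq_card_independent)
  then show ?thesis by blast
qed

lemma isotropic_codes_incidence:
  fixes v :: "'a::{field,finite} ^ ('n::finite + 'n)"
  assumes "v \<noteq> 0"
  shows "card (isotropic_codes k :: ('a ^ ('n + 'n)) set set) * (CARD('a) ^ k - 1)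
    = card {C \<in> isotropic_codes k. v \<in> C} * (CARD('a) ^ (2 * CARD('n)) - 1)"
proof -
  let ?N = "isotropic_codes k :: ('a ^ ('n + 'n)) set set"
  let ?V = "UNIV - {0 :: 'a ^ ('n + 'n)}"
  have "card {u \<in> ?V. u \<in> C} = CARD('a) ^ k - 1" if "C \<in> ?N" for C
  proof -
    have C: "vec.subspace C" "vec.dim C = k" using that by (auto simp: isotropic_codes_def)
    have "{u \<in> ?V. u \<in> C} = C - {0}" by auto
    then show ?thesis using C card_subspace[of C] by (simp add: vec.subspace_0)
  qed
  then have "card ?N * (CARD('a) ^ k - 1) = (\<Sum>C\<in>?N. card {u \<in> ?V. u \<in> C})"
    by simp
  \<comment> \<open>Double counting of pairs of a code and a nonzero vector in it: each such vector
    lies in as many codes as \<open>v\<close>.\<close>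
  also have "\<dots> = card {C \<in> ?N. v \<in> C} * card ?V"
    by (rule sum_multicount) (auto intro!: card_isotropic_codes_containing assms)
  also have "card ?V = CARD('a) ^ (2 * CARD('n)) - 1"
    by (simp add: card_Diff_singleton mult_2)
  finally show ?thesis .
qed

section \<open>Counting vectors by symplectic weight\<close>

definition symp_support :: "'a::field ^ ('n::finite + 'n) \<Rightarrow> 'n set" where
  "symp_support v = {i. (v $ Inl i, v $ Inr i) \<noteq> (0, 0)}"

lemma symp_weight_eq: "symp_weight v = card (symp_support v)"
  by (simp add: symp_weight_def symp_support_def lhalf_def rhalf_def)

lemma symp_weight_eq_0_iff: "symp_weight v = 0 \<longleftrightarrow> v = 0"
proof -
  have "symp_weight v = 0 \<longleftrightarrow> (\<forall>i. v $ Inl i = 0 \<and> v $ Inr i = 0)"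
    by (auto simp: symp_weight_eq symp_support_def)
  also have "\<dots> \<longleftrightarrow> v = 0"
    by (auto simp: vec_eq_iff split_sum_all)
  finally show ?thesis .
qed

lemma card_symp_support_eq:
  fixes S :: "'n::finite set"
  shows "card {v :: 'a::{field,finite} ^ ('n + 'n). symp_support v = S}
    = (CARD('a) ^ 2 - 1) ^ card S"
proof -
  \<comment> \<open>A vector with support \<open>S\<close> amounts to a free choice, at each
    position of \<open>S\<close>, of one of the \<open>CARD('a) ^ 2 - 1\<close> nonzero
    pairs.\<close>
  let ?P = "S \<rightarrow>\<^sub>E (UNIV - {(0, 0)}) :: ('n \<Rightarrow> 'a \<times> 'a) set"
  let ?f = "\<lambda>v :: 'a ^ ('n + 'n). restrict (\<lambda>i. (v $ Inl i, v $ Inr i)) S"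
  let ?g = "\<lambda>h. \<chi> j. case j of Inl i \<Rightarrow> if i \<in> S then fst (h i) else 0
                               | Inr i \<Rightarrow> if i \<in> S then snd (h i) else (0 :: 'a)"
  have "bij_betw ?f {v. symp_support v = S} ?P"
  proof (rule bij_betw_byWitness[where f' = ?g])
    show "\<forall>v\<in>{v. symp_support v = S}. ?g (?f v) = v"
      by (auto simp: vec_eq_iff symp_support_def split: sum.split)
    show "\<forall>h\<in>?P. ?f (?g h) = h"
      by (auto simp: fun_eq_iff PiE_iff extensional_def)
    show "?f ` {v. symp_support v = S} \<subseteq> ?P"
      by (auto simp: symp_support_def)
    show "?g ` ?P \<subseteq> {v. symp_support v = S}"
      by (auto simp: symp_support_def PiE_iff prod_eq_iff split: if_splits)
  qed
  then have "card {v :: 'a ^ ('n + 'n). symp_support v = S} = card ?P"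
    by (rule bij_betw_same_card)
  also have "\<dots> = (CARD('a) ^ 2 - 1) ^ card S"
    by (simp add: card_funcsetE card_Diff_singleton power2_eq_square)
  finally show ?thesis .
qed

lemma card_symp_weight_eq:
  "card {v :: 'a::{field,finite} ^ ('n::finite + 'n). symp_weight v = i}
    = (CARD('n) choose i) * (CARD('a) ^ 2 - 1) ^ i"
proof -
  have "{v :: 'a ^ ('n + 'n). symp_weight v = i}
      = (\<Union>S\<in>{S. card S = i}. {v. symp_support v = S})"
    by (auto simp: symp_weight_eq)
  also have "card \<dots> = (\<Sum>S\<in>{S :: 'n set. card S = i}.
      card {v :: 'a ^ ('n + 'n). symp_support v = S})"
    by (rule card_UN_disjoint) auto
  also have "\<dots> = card {S :: 'n set. card S = i} * (CARD('a) ^ 2 - 1) ^ i"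
    by (simp add: card_symp_support_eq)
  also have "card {S :: 'n set. card S = i} = CARD('n) choose i"
    using n_subsets[of "UNIV :: 'n set" i] by simp
  finally show ?thesis .
qed

lemma card_small_symp_weight:
  "card {v :: 'a::{field,finite} ^ ('n::finite + 'n). v \<noteq> 0 \<and> symp_weight v < d}
    = (\<Sum>i=1..d-1. (CARD('n) choose i) * (CARD('a) ^ 2 - 1) ^ i)"
proof -
  \<comment> \<open>Excluding the zero vector removes exactly weight 0, so the range starts at
    1.\<close>
  have "symp_weight v \<in> {1..d-1} \<longleftrightarrow> v \<noteq> 0 \<and> symp_weight v < d" for v :: "'a ^ ('n + 'n)"
    using symp_weight_eq_0_iff[of v] by (auto simp: Suc_le_eq)
  then have "{v :: 'a ^ ('n + 'n). v \<noteq> 0 \<and> symp_weight v < d}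
      = (\<Union>i\<in>{1..d-1}. {v. symp_weight v = i})"
    by blast
  also have "card \<dots> = (\<Sum>i=1..d-1. card {v :: 'a ^ ('n + 'n). symp_weight v = i})"
    by (rule card_UN_disjoint) auto
  finally show ?thesis by (simp only: card_symp_weight_eq)
qed

theorem theorem3p4:
  fixes q n k d :: nat
  assumes q: "q = CARD('a::{field,finite})"
    and n: "n = CARD('n::finite)"
    and k: "1 \<le> k" "k \<le> n"
    and d: "1 \<le> d"
    and bound: "(\<Sum>i=1..d-1. real (n choose i) * (real q ^ 2 - 1) ^ i)
                  < (real q ^ (2 * n) - 1) / (real q ^ k - 1)"
  shows "\<exists>C :: ('a ^ ('n + 'n)) set.
           vec.subspace C \<and> vec.dim C = k \<and> symp_self_orthogonal C \<and> d \<le> symp_min_dist C"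
proof (rule ccontr)
  assume contra: "\<not> ?thesis"
  let ?N = "isotropic_codes k :: ('a ^ ('n + 'n)) set set"
  let ?B = "{v :: 'a ^ ('n + 'n). v \<noteq> 0 \<and> symp_weight v < d}"
  have q2: "2 \<le> q" unfolding q by (rule two_le_card_field)
  then have q1: "1 \<le> q ^ m" for m by simp
  have qk: "1 < q ^ k" using q2 k by (intro one_less_power) auto
  have meets: "\<exists>v\<in>?B. v \<in> C" if C: "C \<in> ?N" for C
  proof -
    have sub: "vec.subspace C" "vec.dim C = k" using C by (auto simp: isotropic_codes_def)
    then have "card C = q ^ k" using card_subspace q by blast
    \<comment> \<open>As \<open>k\<close> is positive, \<open>C\<close> has more than one element.
      The minimum is thus over a nonempty set and is attained by a nonzero vector of weight below
      \<open>d\<close>.\<close>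
    then have "C - {0} \<noteq> {}"
      using qk by (metis One_nat_def card.empty card_insert_disjoint card_mono diff_shunt_var
          finite.emptyI finite_insert insert_absorb not_le empty_iff)
    moreover have "symp_min_dist C < d"
      using contra C by (auto simp: isotropic_codes_def not_le)
    ultimately show ?thesis by (auto simp: symp_min_dist_def Min_less_iff)
  qed
  \<comment> \<open>Any nonzero vector serves as reference; the index \<open>undefined\<close> is an
    arbitrary choice.\<close>
  define w :: "'a ^ ('n + 'n)" where "w = axis (Inl undefined) 1"
  have w: "w \<noteq> 0" by (simp add: w_def axis_eq_0_iff)
  define M where "M = card {C \<in> ?N. w \<in> C}"
  have "?N = (\<Union>v\<in>?B. {C \<in> ?N. v \<in> C})" using meets by blast
  then have "card ?N \<le> (\<Sum>v\<in>?B. card {C \<in> ?N. v \<in> C})"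
    using card_UN_le[of ?B "\<lambda>v. {C \<in> ?N. v \<in> C}"] by simp
  also have "\<dots> = (\<Sum>v\<in>?B. M)"
    unfolding M_def by (intro sum.cong card_isotropic_codes_containing w) auto
  also have "\<dots> = card ?B * M" by simp
  finally have le: "card ?N \<le> card ?B * M" .
  have inc: "card ?N * (q ^ k - 1) = M * (q ^ (2 * n) - 1)"
    unfolding M_def q n by (rule isotropic_codes_incidence[OF w])
  have "card ?N > 0"
    using isotropic_codes_nonempty[where 'a = 'a and 'n = 'n] k n by (simp add: card_gt_0_iff)
  with inc qk have M: "M > 0" by (intro gr0I) auto
  \<comment> \<open>The union bound times \<open>q ^ k - 1\<close>, rewritten with the incidence
    identity so that \<open>M\<close> cancels.\<close>
  have "M * (q ^ (2 * n) - 1) \<le> M * (card ?B * (q ^ k - 1))"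
    using mult_le_mono1[OF le, of "q ^ k - 1"] inc by (simp only: mult_ac)
  then have "q ^ (2 * n) - 1 \<le> card ?B * (q ^ k - 1)"
    using M by (rule mult_left_le_imp_le)
  then have "real (q ^ (2 * n) - 1) \<le> real (card ?B) * real (q ^ k - 1)"
    unfolding of_nat_mult[symmetric] of_nat_le_iff .
  \<comment> \<open>Powers of \<open>q\<close> are at least 1, so truncated subtraction of naturals
    agrees with real subtraction.\<close>
  moreover have "real (card ?B) = (\<Sum>i=1..d-1. real (n choose i) * (real q ^ 2 - 1) ^ i)"
    unfolding card_small_symp_weight using q1[of 2] by (simp add: q n of_nat_diff)
  moreover have "1 < real q ^ k" using qk by (metis of_nat_less_iff of_nat_1 of_nat_power)
  ultimately show False
    using bound q1 by (simp add: of_nat_diff pos_less_divide_eq)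
qed

end
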